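(* Let $X$ be a visual Gromov hyperbolic space. Then for any visual metric on the boundary at infinity $\partial_\infty X$, $$\operatorname{asdim} X\le \operatorname{cdim}\partial_\infty X+1 .$$
   Context: Gromov product: for a base point $o$ of a metric space $X$, $(x|x')_o=\tfrac12(|xo|+|x'o|-|xx'|)$. $X$ is (Gromov) hyperbolic if for some $\delta\ge0$, some base point $o$ and all $x,x',x''\in X$: $(x|x'')_o\ge\min\{(x|x')_o,(x'|x'')_o\}-\delta$ (geodesicity is not assumed). A sequence $(x_i)$ converges to infinity if $(x_i|x_j)_o\to\infty$ as $i,j\to\infty$; two such sequences $(x_i),(x_i')$ are equivalent if $(x_i|x_i')_o\to\infty$; $\partial_\infty X$ is the set of equivalence classes. For $\xi,\xi'\in\partial_\infty X$, $(\xi|\xi')_o=\inf\liminf_i (x_i|x_i')_o$ over representatives, and for $x\in X$, $(x|\xi)_o=\inf\liminf_i(x|x_i)_o$. A metric $d$ on $\partial_\infty X$ is visual if there are $o\in X$, $a>1$, $c_1,c_2>0$ with $c_1a^{-(\xi|\xi')_o}\le d(\xi,\xi')\le c_2a^{-(\xi|\xi')_o}$ for all $\xi,\xi'$. A hyperbolic space $X$ is visual if for some base point $x_0$ there is $D>0$ such that for every $x\in X$ there is $\xi\in\partial_\infty X$ with $|xx_0|\le (x|\xi)_{x_0}+D$. Uniform polyhedron: for an index set $J$ let $\mathbb R^J$ be the space of finitely supported functions $J\to\mathbb R$ with the Euclidean ($\ell^2$) distance, and $\Delta^J=\{x: x_j\ge0,\ \sum x_j=1\}$; a simplicial polyhedron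 with a uniform metric is one isometric to a subcomplex of some $\Delta^J$ (with the restricted distance). Asymptotic dimension: $\operatorname{asdim}X$ is the minimal $n$ such that for every $\lambda>0$ there is a $\lambda$-Lipschitz map $f:X\to P$ into a uniform simplicial polyhedron $P$ of dimension $\le n$ such that the preimages $f^{-1}(\sigma)$ of all simplices $\sigma\subset P$ have uniformly bounded diameter. Capacity dimension: Let $Z$ be a metric space. For a family $\mathcal U$ of subsets and $z\in Z$: $\operatorname{mesh}(\mathcal U,z)=\sup\{\operatorname{diam}U: z\in U\in\mathcal U\}$, $\operatorname{mesh}(\mathcal U)=\sup\{\operatorname{diam}U:U\in\mathcal U\}$. A covering is $(m+1)$-colored if it is a union of $m+1$ subfamilies each consisting of pairwise disjoint sets. For an open covering $\mathcal U$: $L(\mathcal U,z)=\min\{\sup_{U\in\mathcal U}\operatorname{dist}(z,Z\setminus U),\ \operatorname{mesh}(\mathcal U,z)\}$, $L(\mathcal U)=\inf_{z}L(\mathcal U,z)$ (Lebesgue number), and the capacity $\operatorname{cap}(\mathcal U)=L(\mathcal U)/\operatorname{mesh}(\mathcal U)\in[0,1]$, with $\operatorname{cap}(\mathcal U)=1$ if $\operatorname{mesh}(\mathcal U)=0$ or $L(\mathcal U)=\operatorname{mesh}(\mathcal U)=\infty$. For $\tau>0$, $\delta\in(0,1)$, integer $m\ge0$, let $c_\tau(Z,m,\delta)$ be the supremum of $\operatorname{cap}(\mathcal U)$ over open $(m+1)$-colored coverings $\mathcal U$ of $Z$ with $\delta\tau\le\operatorname{mesh}(\mathcal U)\le\tau$;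 $c(Z,m,\delta)=\liminf_{\tau\to0}c_\tau(Z,m,\delta)$; $c(Z,m)=\lim_{\delta\to0}c(Z,m,\delta)$ (monotone limit); $\operatorname{cdim}Z=\inf\{m: c(Z,m)>0\}$. *)

theory Defs
  imports "HOL-Analysis.Analysis"
begin

definition gromov_prod :: "'a::metric_space \<Rightarrow> 'a \<Rightarrow> 'a \<Rightarrow> real" where
  "gromov_prod p x x' = (dist x p + dist x' p - dist x x') / 2"

definition gromov_hyperbolic :: "'a::metric_space itself \<Rightarrow> bool" where
  "gromov_hyperbolic _ \<longleftrightarrow> (\<exists>\<delta>::real. \<delta> \<ge> 0 \<and> (\<exists>p::'a. \<forall>x x' x''.
     gromov_prod p x x'' \<ge> min (gromov_prod p x x') (gromov_prod p x' x'') - \<delta>))"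

definition conv_infty :: "'a::metric_space \<Rightarrow> (nat \<Rightarrow> 'a) \<Rightarrow> bool" where
  "conv_infty p s \<longleftrightarrow> (\<forall>M. \<exists>N. \<forall>i\<ge>N. \<forall>j\<ge>N. gromov_prod p (s i) (s j) \<ge> M)"

definition seq_equiv :: "'a::metric_space \<Rightarrow> (nat \<Rightarrow> 'a) \<Rightarrow> (nat \<Rightarrow> 'a) \<Rightarrow> bool" where
  "seq_equiv p s s' \<longleftrightarrow> filterlim (\<lambda>i. gromov_prod p (s i) (s' i)) at_top sequentially"

definition boundary :: "'a::metric_space \<Rightarrow> (nat \<Rightarrow> 'a) set set" where
  "boundary b = {{s'. conv_infty b s' \<and> seq_equiv b s s'} | s. conv_infty b s}"

definition gromov_prod_bdry :: "'a::metric_space \<Rightarrow> (nat \<Rightarrow> 'a) set \<Rightarrow> (nat \<Rightarrow> 'a) set \<Rightarrow> ereal" where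
  "gromov_prod_bdry p \<xi> \<xi>' = (INF q \<in> \<xi> \<times> \<xi>'.
      liminf (\<lambda>i. ereal (gromov_prod p (fst q i) (snd q i))))"

definition gromov_prod_pt_bdry :: "'a::metric_space \<Rightarrow> 'a \<Rightarrow> (nat \<Rightarrow> 'a) set \<Rightarrow> ereal" where
  "gromov_prod_pt_bdry p x \<xi> = (INF s \<in> \<xi>. liminf (\<lambda>i. ereal (gromov_prod p x (s i))))"

definition epowr_neg :: "real \<Rightarrow> ereal \<Rightarrow> real" where
  "epowr_neg a t = (if t = \<infinity> then 0 else a powr (- real_of_ereal t))"

definition metric_on :: "'b set \<Rightarrow> ('b \<Rightarrow> 'b \<Rightarrow> real) \<Rightarrow> bool" where
  "metric_on Z d \<longleftrightarrow> (\<forall>x\<in>Z. \<forall>y\<in>Z. d x y \<ge> 0 \<and> (d x y = 0 \<longleftrightarrow> x = y) \<and> d x y = d y x) \<and>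
     (\<forall>x\<in>Z. \<forall>y\<in>Z. \<forall>z\<in>Z. d x z \<le> d x y + d y z)"

definition visual_metric :: "'a::metric_space \<Rightarrow> ((nat \<Rightarrow> 'a) set \<Rightarrow> (nat \<Rightarrow> 'a) set \<Rightarrow> real) \<Rightarrow> bool" where
  "visual_metric b d \<longleftrightarrow> metric_on (boundary b) d \<and>
     (\<exists>(p::'a) (a::real) (c1::real) (c2::real). a > 1 \<and> c1 > 0 \<and> c2 > 0 \<and>
       (\<forall>\<xi>\<in>boundary b. \<forall>\<xi>'\<in>boundary b.
          c1 * epowr_neg a (gromov_prod_bdry p \<xi> \<xi>') \<le> d \<xi> \<xi>' \<and>
          d \<xi> \<xi>' \<le> c2 * epowr_neg a (gromov_prod_bdry p \<xi> \<xi>')))"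

definition visual_space :: "'a::metric_space \<Rightarrow> bool" where
  "visual_space b \<longleftrightarrow> (\<exists>(x0::'a) (D::real). D > 0 \<and> (\<forall>x. \<exists>\<xi>\<in>boundary b.
     ereal (dist x x0) \<le> gromov_prod_pt_bdry x0 x \<xi> + ereal D))"

definition fsupp :: "('j \<Rightarrow> real) \<Rightarrow> 'j set" where
  "fsupp x = {j. x j \<noteq> 0}"

definition l2_dist :: "('j \<Rightarrow> real) \<Rightarrow> ('j \<Rightarrow> real) \<Rightarrow> real" where
  "l2_dist x y = sqrt (\<Sum>j \<in> fsupp x \<union> fsupp y. (x j - y j)^2)"

definition std_simplex :: "('j \<Rightarrow> real) set" where
  "std_simplex = {x. finite (fsupp x) \<and> (\<forall>j. x j \<ge> 0) \<and> (\<Sum>j\<in>fsupp x. x j) = 1}"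

definition face :: "'j set \<Rightarrow> ('j \<Rightarrow> real) set" where
  "face S = {x \<in> std_simplex. fsupp x \<subseteq> S}"

definition simp_complex :: "nat \<Rightarrow> 'j set set \<Rightarrow> bool" where
  "simp_complex n K \<longleftrightarrow> (\<forall>S\<in>K. finite S \<and> S \<noteq> {} \<and> card S \<le> n + 1) \<and>
     (\<forall>S\<in>K. \<forall>T. T \<subseteq> S \<and> T \<noteq> {} \<longrightarrow> T \<in> K)"

definition polyhedron :: "'j set set \<Rightarrow> ('j \<Rightarrow> real) set" where
  "polyhedron K = (\<Union>S\<in>K. face S)"

text \<open>asdim X \<le> n, with the index set J taken to be 'a \<times> nat (large enough).\<close>
definition asdim_le :: "'a::metric_space itself \<Rightarrow> nat \<Rightarrow> bool" where
  "asdim_le _ n \<longleftrightarrow> (\<forall>L::real. L > 0 \<longrightarrow>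
     (\<exists>(K :: ('a \<times> nat) set set) (f :: 'a \<Rightarrow> ('a \<times> nat \<Rightarrow> real)).
        simp_complex n K \<and> (\<forall>x. f x \<in> polyhedron K) \<and>
        (\<forall>x y. l2_dist (f x) (f y) \<le> L * dist x y) \<and>
        (\<exists>C::real. \<forall>S\<in>K. \<forall>x y. f x \<in> face S \<and> f y \<in> face S \<longrightarrow> dist x y \<le> C)))"

definition asdim :: "'a::metric_space itself \<Rightarrow> enat" where
  "asdim X = (if \<exists>n. asdim_le X n then enat (LEAST n. asdim_le X n) else \<infinity>)"

definition ediam :: "('b \<Rightarrow> 'b \<Rightarrow> real) \<Rightarrow> 'b set \<Rightarrow> ereal" where
  "ediam d A = Sup ({0} \<union> {ereal (d x y) | x y. x \<in> A \<and> y \<in> A})"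

definition mesh_at :: "('b \<Rightarrow> 'b \<Rightarrow> real) \<Rightarrow> 'b set set \<Rightarrow> 'b \<Rightarrow> ereal" where
  "mesh_at d U z = Sup ({0} \<union> {ediam d V | V. z \<in> V \<and> V \<in> U})"

definition mesh :: "('b \<Rightarrow> 'b \<Rightarrow> real) \<Rightarrow> 'b set set \<Rightarrow> ereal" where
  "mesh d U = Sup ({0} \<union> ediam d ` U)"

definition dist_compl :: "'b set \<Rightarrow> ('b \<Rightarrow> 'b \<Rightarrow> real) \<Rightarrow> 'b \<Rightarrow> 'b set \<Rightarrow> ereal" where
  "dist_compl Z d z V = (INF w \<in> Z - V. ereal (d z w))"

definition leb_at :: "'b set \<Rightarrow> ('b \<Rightarrow> 'b \<Rightarrow> real) \<Rightarrow> 'b set set \<Rightarrow> 'b \<Rightarrow> ereal" where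
  "leb_at Z d U z = min (SUP V \<in> U. dist_compl Z d z V) (mesh_at d U z)"

definition leb :: "'b set \<Rightarrow> ('b \<Rightarrow> 'b \<Rightarrow> real) \<Rightarrow> 'b set set \<Rightarrow> ereal" where
  "leb Z d U = (INF z \<in> Z. leb_at Z d U z)"

definition capacity :: "'b set \<Rightarrow> ('b \<Rightarrow> 'b \<Rightarrow> real) \<Rightarrow> 'b set set \<Rightarrow> ereal" where
  "capacity Z d U = (if mesh d U = 0 \<or> (leb Z d U = \<infinity> \<and> mesh d U = \<infinity>) then 1
                     else leb Z d U / mesh d U)"

definition open_in_sp :: "'b set \<Rightarrow> ('b \<Rightarrow> 'b \<Rightarrow> real) \<Rightarrow> 'b set \<Rightarrow> bool" where
  "open_in_sp Z d V \<longleftrightarrow> V \<subseteq> Z \<and> (\<forall>x\<in>V. \<exists>e>0. \<forall>y\<in>Z. d x y < e \<longrightarrow> y \<in> V)"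

definition open_cover :: "'b set \<Rightarrow> ('b \<Rightarrow> 'b \<Rightarrow> real) \<Rightarrow> 'b set set \<Rightarrow> bool" where
  "open_cover Z d U \<longleftrightarrow> (\<forall>V\<in>U. open_in_sp Z d V) \<and> \<Union>U = Z"

definition colored :: "nat \<Rightarrow> 'b set set \<Rightarrow> bool" where
  "colored k U \<longleftrightarrow> (\<exists>F :: nat \<Rightarrow> 'b set set. U = (\<Union>i<k. F i) \<and>
      (\<forall>i<k. \<forall>V\<in>F i. \<forall>W\<in>F i. V \<noteq> W \<longrightarrow> V \<inter> W = {}))"

definition c_tau :: "'b set \<Rightarrow> ('b \<Rightarrow> 'b \<Rightarrow> real) \<Rightarrow> real \<Rightarrow> nat \<Rightarrow> real \<Rightarrow> ereal" where
  "c_tau Z d \<tau> m \<delta> = (SUP U \<in> {U. open_cover Z d U \<and> colored (m + 1) U \<and>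
        ereal (\<delta> * \<tau>) \<le> mesh d U \<and> mesh d U \<le> ereal \<tau>}. capacity Z d U)"

definition c_delta :: "'b set \<Rightarrow> ('b \<Rightarrow> 'b \<Rightarrow> real) \<Rightarrow> nat \<Rightarrow> real \<Rightarrow> ereal" where
  "c_delta Z d m \<delta> = Liminf (at_right 0) (\<lambda>\<tau>. c_tau Z d \<tau> m \<delta>)"

text \<open>The monotone limit as \<delta> \<rightarrow> 0 (\<delta> in (0,1)); written as a lower limit,
  which coincides with the limit since it exists.\<close>
definition c_cap :: "'b set \<Rightarrow> ('b \<Rightarrow> 'b \<Rightarrow> real) \<Rightarrow> nat \<Rightarrow> ereal" where
  "c_cap Z d m = Liminf (at_right 0) (\<lambda>\<delta>. c_delta Z d m \<delta>)"

definition cdim :: "'b set \<Rightarrow> ('b \<Rightarrow> 'b \<Rightarrow> real) \<Rightarrow> enat" where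
  "cdim Z d = (if \<exists>m. c_cap Z d m > 0 then enat (LEAST m. c_cap Z d m > 0) else \<infinity>)"

end

theory Submission
  imports Defs
begin

text \<open>A point \<open>x\<close> of a visual space is projected to a boundary point \<open>\<pi> x\<close> that it nearly looks
  towards. On a strip \<open>t \<le> dist x x\<^sub>0 < t + w\<close>, pulling back a coloured covering of the boundary at
  scale about \<open>a powr - t\<close> gives \<open>m + 1\<close> families of uniformly bounded, far apart sets, with bounds
  independent of \<open>t\<close>; so the strips have asymptotic dimension at most \<open>m\<close>, uniformly. A Hurewicz
  argument for the distance to \<open>x\<^sub>0\<close> then costs one more colour. By Kolmogorov's trick each strip is
  covered twice by \<open>m + 2\<close> families. Cut the line into unit levels and let colour \<open>i\<close> omit the levels
  congruent to \<open>i\<close> modulo \<open>m + 2\<close>: every point survives in one of its two colours, and the omitted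
  levels separate the blocks that remain. A block meets only two adjacent strips, whose families are
  merged by a saturated union.\<close>

section \<open>Families of uniformly bounded, uniformly separated sets\<close>

definition coarse_family :: "real \<Rightarrow> real \<Rightarrow> 'a::metric_space set set \<Rightarrow> bool" where
  "coarse_family R D F \<longleftrightarrow> (\<forall>U\<in>F. \<forall>x\<in>U. \<forall>y\<in>U. dist x y \<le> D) \<and>
     (\<forall>U\<in>F. \<forall>V\<in>F. U \<noteq> V \<longrightarrow> (\<forall>x\<in>U. \<forall>y\<in>V. R \<le> dist x y))"

lemma coarse_familyI:
  assumes "\<And>U x y. U \<in> F \<Longrightarrow> x \<in> U \<Longrightarrow> y \<in> U \<Longrightarrow> dist x y \<le> D"
    and "\<And>U V x y. U \<in> F \<Longrightarrow> V \<in> F \<Longrightarrow> x \<in> U \<Longrightarrow> y \<in> V \<Longrightarrow> dist x y < R \<Longrightarrow> U = V"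
  shows "coarse_family R D F"
  unfolding coarse_family_def using assms by (meson not_le)

lemma coarse_family_bounded:
  "coarse_family R D F \<Longrightarrow> U \<in> F \<Longrightarrow> x \<in> U \<Longrightarrow> y \<in> U \<Longrightarrow> dist x y \<le> D"
  unfolding coarse_family_def by blast

lemma coarse_family_eq:
  "coarse_family R D F \<Longrightarrow> U \<in> F \<Longrightarrow> V \<in> F \<Longrightarrow> x \<in> U \<Longrightarrow> y \<in> V \<Longrightarrow> dist x y < R \<Longrightarrow> U = V"
  unfolding coarse_family_def by (meson not_le)

section \<open>From coloured covers to maps into polyhedra\<close>

text \<open>The numerators are 1-Lipschitz, and normalising is harmless because the sums are at
  least \<open>r\<close>. Two points involve at most \<open>2 * N\<close> indices, so adding up
  coordinate bounds controls the l2 distance.\<close>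

lemma l2_dist_partition_of_unity_le:
  fixes \<phi> :: "'j \<Rightarrow> 'a::metric_space \<Rightarrow> real" and N :: nat
  defines "supp \<equiv> \<lambda>x. {j. \<phi> j x \<noteq> 0}"
  defines "f \<equiv> \<lambda>x j. \<phi> j x / (\<Sum>i\<in>supp x. \<phi> i x)"
  assumes nonneg: "\<And>j x. 0 \<le> \<phi> j x"
    and lip: "\<And>j x y. \<bar>\<phi> j x - \<phi> j y\<bar> \<le> dist x y"
    and fin: "\<And>x. finite (supp x)" and card: "\<And>x. card (supp x) \<le> N"
    and r: "0 < r" "\<And>x. r \<le> (\<Sum>i\<in>supp x. \<phi> i x)"
  shows "l2_dist (f x) (f y) \<le> 2 * N * (1 + 2 * N) / r * dist x y"
proof -
  define T where "T = supp x \<union> supp y"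
  define S where "S z = (\<Sum>i\<in>supp z. \<phi> i z)" for z
  have S: "r \<le> S z" "0 < S z" for z using r(1) r(2)[of z] by (auto simp: S_def)
  have finT: "finite T" by (simp add: T_def fin)
  have cardT: "real (card T) \<le> 2 * N"
    using card_Un_le[of "supp x" "supp y"] card[of x] card[of y] by (simp add: T_def)
  have ST: "S z = (\<Sum>i\<in>T. \<phi> i z)" if "z \<in> {x, y}" for z
    unfolding S_def using finT that by (intro sum.mono_neutral_left) (auto simp: T_def supp_def)
  have fS: "f z j = \<phi> j z / S z" for z j by (simp add: f_def S_def)
  have fsupp: "fsupp (f z) = supp z" for z
    using S(2)[of z] by (auto simp: fsupp_def fS supp_def)
  have "\<bar>S y - S x\<bar> \<le> (\<Sum>i\<in>T. \<bar>\<phi> i y - \<phi> i x\<bar>)"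
    using ST[of x] ST[of y] by (simp add: sum_abs flip: sum_subtractf)
  also have "\<dots> \<le> (\<Sum>i\<in>T. dist x y)"
    using lip[of _ y x] by (intro sum_mono) (simp add: dist_commute)
  also have "\<dots> \<le> 2 * N * dist x y" using mult_right_mono[OF cardT, of "dist x y"] by simp
  finally have Sdiff: "\<bar>S y - S x\<bar> \<le> 2 * N * dist x y" .
  have coord: "\<bar>f x j - f y j\<bar> \<le> (1 + 2 * N) / r * dist x y" if "j \<in> T" for j
  proof -
    have "\<phi> j y \<le> S y"
      using ST[of y] member_le_sum[of j T "\<lambda>i. \<phi> i y"] that finT nonneg by simp
    then have q: "\<phi> j y / S y \<le> 1" "0 \<le> \<phi> j y / S y"
      using S(2)[of y] nonneg[of j y] by auto
    \<comment> \<open>The change of the quotient is split into that of the numerator and that of the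
      normalising sum; the weight \<open>\<phi> j y / S y\<close> of the latter lies in
      [0, 1].\<close>
    have "f x j - f y j = ((\<phi> j x - \<phi> j y) + \<phi> j y / S y * (S y - S x)) / S x"
      using S(2)[of x] S(2)[of y] by (simp add: fS field_simps)
    then have "\<bar>f x j - f y j\<bar> = \<bar>(\<phi> j x - \<phi> j y) + \<phi> j y / S y * (S y - S x)\<bar> / S x"
      using S(2)[of x] by simp
    also have "\<dots> \<le> (\<bar>\<phi> j x - \<phi> j y\<bar> + \<bar>S y - S x\<bar>) / S x"
    proof (rule divide_right_mono)
      have "\<bar>\<phi> j y / S y * (S y - S x)\<bar> \<le> 1 * \<bar>S y - S x\<bar>"
        unfolding abs_mult using q by (intro mult_right_mono) auto
      then show "\<bar>(\<phi> j x - \<phi> j y) + \<phi> j y / S y * (S y - S x)\<bar> \<le> \<bar>\<phi> j x - \<phi> j y\<bar> + \<bar>S y - S x\<bar>"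
        using abs_triangle_ineq[of "\<phi> j x - \<phi> j y" "\<phi> j y / S y * (S y - S x)"] by simp
    qed (use S(2)[of x] in simp)
    also have "\<dots> \<le> (dist x y + 2 * N * dist x y) / r"
      using lip[of j x y] Sdiff S(1)[of x] r(1) by (intro frac_le) auto
    finally show ?thesis by (simp add: algebra_simps)
  qed
  have "l2_dist (f x) (f y) = L2_set (\<lambda>j. f x j - f y j) T"
    by (simp add: l2_dist_def L2_set_def fsupp T_def)
  also have "\<dots> \<le> (\<Sum>j\<in>T. \<bar>f x j - f y j\<bar>)" by (rule L2_set_le_sum_abs)
  also have "\<dots> \<le> (\<Sum>j\<in>T. (1 + 2 * N) / r * dist x y)" by (intro sum_mono coord)
  also have "\<dots> = real (card T) * ((1 + 2 * N) / r * dist x y)" by simp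
  also have "\<dots> \<le> 2 * N * ((1 + 2 * N) / r * dist x y)"
    using cardT r(1) by (intro mult_right_mono) auto
  finally show ?thesis by (simp add: algebra_simps)
qed

lemma abs_max_diff_infdist_le:
  "\<bar>max 0 (r - infdist x A) - max 0 (r - infdist y A)\<bar> \<le> dist x y"
  using infdist_triangle[of x A y] infdist_triangle[of y A x] by (auto simp: dist_commute)

text \<open>Normalised bumps around the sets map the space to a nerve. Sets of one colour are too
  far apart for a point to be near two of them, so a point sees at most \<open>n + 1\<close>
  vertices.\<close>

lemma asdim_le_if_coloured_covers:
  assumes "\<And>R. 0 < R \<Longrightarrow> \<exists>D (F :: nat \<Rightarrow> 'a set set).
      (\<forall>i\<le>n. coarse_family R D (F i)) \<and> (\<forall>x. \<exists>i\<le>n. x \<in> \<Union>(F i))"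
  shows "asdim_le TYPE('a::metric_space) n"
  unfolding asdim_le_def
proof (intro allI impI)
  fix L :: real assume L: "0 < L"
  define N where "N = Suc n"
  \<comment> \<open>With this radius the Lipschitz constant of the partition of unity is exactly
    \<open>L\<close>.\<close>
  define r where "r = 2 * N * (1 + 2 * N) / L"
  have N: "0 < N" by (simp add: N_def)
  have r: "0 < r" using L N by (simp add: r_def add_pos_nonneg)
  obtain D and F :: "nat \<Rightarrow> 'a set set"
    where F: "\<And>i. i \<le> n \<Longrightarrow> coarse_family (2 * r) D (F i)" and cover: "\<And>x. \<exists>i\<le>n. x \<in> \<Union>(F i)"
  proof -
    have "0 < 2 * r" using r by simp
    from assms[OF this] show thesis using that by blast
  qed
  define P where "P = {(U, i). i \<le> n \<and> U \<in> F i \<and> U \<noteq> {}}"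
  \<comment> \<open>Vertices must lie in \<open>'a \<times> nat\<close>: a coloured set is encoded
    by a chosen point and its colour. This is injective since sets of one colour sharing a point
    coincide.\<close>
  define e where "e = (\<lambda>(U :: 'a set, i :: nat). (SOME x. x \<in> U, i))"
  have e_mem: "fst (e p) \<in> fst p" if "p \<in> P" for p
    using that by (auto simp: P_def e_def some_in_eq)
  have inj: "inj_on e P"
  proof (rule inj_onI)
    fix p q assume pq: "p \<in> P" "q \<in> P" "e p = e q"
    then have "snd p = snd q" by (auto simp: e_def split: prod.splits)
    moreover have "fst p = fst q"
      using coarse_family_eq[OF F, of "snd p" "fst p" "fst q" "fst (e p)" "fst (e q)"]
        e_mem[OF pq(1)] e_mem[OF pq(2)] pq r \<open>snd p = snd q\<close> by (auto simp: P_def)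
    ultimately show "p = q" by (simp add: prod_eq_iff)
  qed
  define W where "W j = fst (inv_into P e j)" for j
  have W: "snd j \<le> n" "W j \<in> F (snd j)" "W j \<noteq> {}" if "j \<in> e ` P" for j
  proof -
    have "inv_into P e j \<in> P" "e (inv_into P e j) = j"
      using that by (auto intro: inv_into_into f_inv_into_f)
    then show "snd j \<le> n" "W j \<in> F (snd j)" "W j \<noteq> {}"
      by (auto simp: P_def W_def e_def split: prod.splits)
  qed
  have W_inj: "j = k" if "j \<in> e ` P" "k \<in> e ` P" "snd j = snd k" "W j = W k" for j k
  proof -
    have e: "e (inv_into P e j) = j" "e (inv_into P e k) = k"
      using that(1,2) by (auto simp only: f_inv_into_f)
    have "snd (e p) = snd p" for p by (simp add: e_def split: prod.splits)
    from this[of "inv_into P e j"] this[of "inv_into P e k"] have "inv_into P e j = inv_into P e k"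
      using that(3,4) by (simp add: e W_def prod_eq_iff)
    then show ?thesis using e by metis
  qed
  define \<phi> where "\<phi> j x = (if j \<in> e ` P then max 0 (r - infdist x (W j)) else 0)" for j x
  define supp where "supp x = {j. \<phi> j x \<noteq> 0}" for x
  define f where "f x j = \<phi> j x / (\<Sum>i\<in>supp x. \<phi> i x)" for x j
  have supp_P: "j \<in> e ` P" if "j \<in> supp x" for j x
    using that unfolding supp_def \<phi>_def by (metis mem_Collect_eq)
  have near: "\<exists>w\<in>W j. dist x w < r" if "j \<in> supp x" for j x
  proof -
    have "infdist x (W j) < r" using that supp_P[OF that] by (simp add: supp_def \<phi>_def max_def split: if_splits)
    then show ?thesis
      using cInf_lessD[of "dist x ` W j" r] W(3)[OF supp_P[OF that]] by (simp add: infdist_def)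
  qed
  have inj_supp: "inj_on snd (supp x)" for x
  proof (rule inj_onI)
    fix j k assume jk: "j \<in> supp x" "k \<in> supp x" "snd j = snd k"
    obtain v w where vw: "v \<in> W j" "dist x v < r" "w \<in> W k" "dist x w < r"
      using near jk by meson
    then have "dist v w < 2 * r" using dist_triangle3[of v w x] by simp
    then have "W j = W k"
      using coarse_family_eq[OF F[OF W(1)] W(2)] W(2) supp_P jk vw by metis
    then show "j = k" by (rule W_inj[OF supp_P[OF jk(1)] supp_P[OF jk(2)] jk(3)])
  qed
  have snd_supp: "snd ` supp x \<subseteq> {..n}" for x using supp_P W(1) by blast
  have fin: "finite (supp x)" for x
    using inj_on_finite[OF inj_supp snd_supp] by simp
  have card: "card (supp x) \<le> N" for x
    using card_inj_on_le[OF inj_supp snd_supp] by (simp add: N_def)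
  have sum_ge: "r \<le> (\<Sum>i\<in>supp x. \<phi> i x)" for x
  proof -
    obtain i U where "i \<le> n" "U \<in> F i" "x \<in> U" using cover by blast
    then have "(U, i) \<in> P" by (auto simp: P_def)
    then have "W (e (U, i)) = U" "e (U, i) \<in> e ` P" using inj by (auto simp: W_def inv_into_f_f)
    then have \<phi>: "\<phi> (e (U, i)) x = r" using r \<open>x \<in> U\<close> by (simp add: \<phi>_def)
    then have "e (U, i) \<in> supp x" using r by (simp add: supp_def)
    then show ?thesis using member_le_sum[of "e (U, i)" "supp x" "\<lambda>i. \<phi> i x"] fin \<phi>
      by (auto simp: \<phi>_def)
  qed
  have sum_pos: "0 < (\<Sum>i\<in>supp x. \<phi> i x)" for x using sum_ge[of x] r by linarith
  have fsupp: "fsupp (f x) = supp x" for x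
    using sum_pos[of x] by (auto simp: fsupp_def f_def supp_def)
  have supp_ne: "supp x \<noteq> {}" for x using sum_pos[of x] by auto
  have simplex: "f x \<in> std_simplex" for x
    using fin sum_pos[of x]
    by (auto simp: std_simplex_def fsupp) (auto simp: f_def \<phi>_def simp flip: sum_divide_distrib)
  \<comment> \<open>All nonempty subsets of supports are taken, as a complex is closed under
    faces.\<close>
  define K where "K = {S. S \<noteq> {} \<and> (\<exists>x. S \<subseteq> supp x)}"
  have "simp_complex n K"
    unfolding simp_complex_def
  proof (intro conjI ballI allI impI)
    fix S assume "S \<in> K"
    then obtain x where S: "S \<noteq> {}" "S \<subseteq> supp x" by (auto simp: K_def)
    show "finite S" "S \<noteq> {}" using S fin finite_subset by auto
    show "card S \<le> n + 1" using card_mono[OF fin S(2)] card[of x] by (simp add: N_def)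
  next
    fix S T assume "S \<in> K" "T \<subseteq> S \<and> T \<noteq> {}"
    then show "T \<in> K" unfolding K_def by blast
  qed
  moreover have "f x \<in> polyhedron K" for x
  proof -
    have "supp x \<in> K" using supp_ne by (auto simp: K_def)
    then show ?thesis using simplex by (auto simp: polyhedron_def face_def fsupp)
  qed
  moreover have "l2_dist (f x) (f y) \<le> L * dist x y" for x y
  proof -
    have "l2_dist (f x) (f y) \<le> 2 * N * (1 + 2 * N) / r * dist x y"
      unfolding f_def supp_def
      by (rule l2_dist_partition_of_unity_le)
        (use fin card sum_ge r abs_max_diff_infdist_le in \<open>auto simp: \<phi>_def supp_def\<close>)
    also have "2 * N * (1 + 2 * N) / r = L" using L r by (auto simp: r_def)
    finally show ?thesis .
  qed
  \<comment> \<open>A simplex sits inside some \<open>supp z\<close>. Every point mapped into it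
    shares a vertex with \<open>z\<close>, so both are within \<open>r\<close> of one set
    \<open>W j\<close>.\<close>
  moreover have "dist x y \<le> 2 * (2 * r + D)" if S: "S \<in> K" "f x \<in> face S" "f y \<in> face S" for S x y
  proof -
    obtain z where z: "S \<subseteq> supp z" using S(1) by (auto simp: K_def)
    have *: "dist u z \<le> 2 * r + D" if u: "f u \<in> face S" for u
    proof -
      obtain j where j: "j \<in> supp u" "j \<in> supp z"
        using u z supp_ne[of u] unfolding face_def mem_Collect_eq fsupp by blast
      obtain v w where vw: "v \<in> W j" "dist u v < r" "w \<in> W j" "dist z w < r"
        using near j by meson
      have "dist v w \<le> D" using coarse_family_bounded[OF F] W[OF supp_P[OF j(1)]] vw by blast
      then show ?thesis
        using vw dist_triangle[of u z v] dist_triangle[of v z w] by (simp add: dist_commute)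
    qed
    show ?thesis using *[OF S(2)] *[OF S(3)] dist_triangle2[of x y z] by (simp add: algebra_simps)
  qed
  ultimately show "\<exists>(K :: ('a \<times> nat) set set) f. simp_complex n K \<and> (\<forall>x::'a. f x \<in> polyhedron K) \<and>
        (\<forall>x y. l2_dist (f x) (f y) \<le> L * dist x y) \<and>
        (\<exists>C::real. \<forall>S\<in>K. \<forall>x y. f x \<in> face S \<and> f y \<in> face S \<longrightarrow> dist x y \<le> C)"
    by (intro exI[of _ K] exI[of _ f] exI[of _ "2 * (2 * r + D)"] conjI allI ballI impI) simp_all
qed

section \<open>A Hurewicz theorem for maps to the line\<close>

text \<open>Kolmogorov's trick: thicken the families; points then lying in one colour only are
  covered again by a new colour, in which different original colours cannot come close.\<close>

lemma ex_doubly_covering_families: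
  fixes F :: "nat \<Rightarrow> 'a::metric_space set set"
  assumes "\<forall>i<N. coarse_family (3 * R) D (F i)" and R: "0 < R"
    and cover: "B \<subseteq> (\<Union>i<N. \<Union>(F i))"
  shows "\<exists>G. (\<forall>i\<le>N. coarse_family R (D + 2 * R) (G i)) \<and>
    (\<forall>x\<in>B. \<exists>i j. i < j \<and> j \<le> N \<and> x \<in> \<Union>(G i) \<and> x \<in> \<Union>(G j))"
proof -
  have F: "coarse_family (3 * R) D (F i)" if "i < N" for i using assms(1) that by blast
  define nb where "nb U = {x. \<exists>u\<in>U. dist x u < R}" for U :: "'a set"
  define C where "C = {x. \<forall>i<N. \<forall>j<N. x \<in> \<Union>(nb ` F i) \<longrightarrow> x \<in> \<Union>(nb ` F j) \<longrightarrow> i = j}"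
  define G where "G i = (if i < N then nb ` F i else (\<lambda>U. U \<inter> C) ` (\<Union>i<N. F i))" for i
  have sub: "U \<subseteq> nb U" for U using R by (auto simp: nb_def intro!: bexI)
  have "coarse_family R (D + 2 * R) (G i)" if i: "i < N" for i
  proof (rule coarse_familyI)
    fix V x y assume "V \<in> G i" "x \<in> V" "y \<in> V"
    then obtain U where "U \<in> F i" "V = nb U"
      using i by (auto simp: G_def)
    then obtain u v where U: "U \<in> F i" "u \<in> U" "v \<in> U" "dist x u < R" "dist y v < R"
      using \<open>x \<in> V\<close> \<open>y \<in> V\<close> unfolding nb_def by blast
    then have "dist u v \<le> D" using coarse_family_bounded[OF F[OF i]] by blast
    then show "dist x y \<le> D + 2 * R"
      using U dist_triangle[of x y u] dist_triangle[of u y v] by (simp add: dist_commute)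
  next
    fix V V' x y assume "V \<in> G i" "V' \<in> G i" "x \<in> V" "y \<in> V'" and xy: "dist x y < R"
    then obtain U U' where U: "U \<in> F i" "U' \<in> F i" "V = nb U" "V' = nb U'"
      using i by (auto simp: G_def)
    then obtain u v where uv: "u \<in> U" "v \<in> U'" "dist x u < R" "dist y v < R"
      using \<open>x \<in> V\<close> \<open>y \<in> V'\<close> unfolding nb_def by blast
    then have "dist u v < 3 * R"
      using xy dist_triangle[of u v x] dist_triangle[of x v y] by (simp add: dist_commute)
    then show "V = V'" using coarse_family_eq[OF F[OF i]] U uv by blast
  qed
  moreover have "coarse_family R (D + 2 * R) (G N)"
  proof (rule coarse_familyI)
    fix V x y assume "V \<in> G N" "x \<in> V" "y \<in> V"
    then obtain i U where "i < N" "U \<in> F i" "x \<in> U" "y \<in> U" by (auto simp: G_def)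
    then show "dist x y \<le> D + 2 * R" using coarse_family_bounded[OF F, of i U x y] R by simp
  next
    fix V V' x y assume "V \<in> G N" "V' \<in> G N" "x \<in> V" "y \<in> V'" and xy: "dist x y < R"
    then obtain i i' U U' where U: "i < N" "i' < N" "U \<in> F i" "U' \<in> F i'"
      "V = U \<inter> C" "V' = U' \<inter> C" "x \<in> U" "y \<in> U'" "y \<in> C"
      by (auto simp: G_def)
    \<comment> \<open>Now \<open>y\<close> lies in thickened sets of the colours \<open>i\<close>
      and \<open>i'\<close>; membership in \<open>C\<close> forces them to agree.\<close>
    have "y \<in> nb U" using U xy by (auto simp: nb_def dist_commute)
    then have "i = i'" using U sub[of U'] unfolding C_def by blast
    then have "U = U'" using coarse_family_eq[OF F, of i U U' x y] U xy R by simp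
    then show "V = V'" using U by simp
  qed
  moreover have "\<exists>i j. i < j \<and> j \<le> N \<and> x \<in> \<Union>(G i) \<and> x \<in> \<Union>(G j)" if x: "x \<in> B" for x
  proof (cases "x \<in> C")
    case True
    obtain i U where U: "i < N" "U \<in> F i" "x \<in> U" using cover x by blast
    then have "x \<in> \<Union>(G i)" "x \<in> \<Union>(G N)" using sub[of U] True by (auto simp: G_def)
    then show ?thesis using U(1) by blast
  next
    case False
    then obtain i j where "i < N" "j < N" "i \<noteq> j" "x \<in> \<Union>(nb ` F i)" "x \<in> \<Union>(nb ` F j)"
      unfolding C_def by blast
    then have "i < N" "j < N" "i \<noteq> j" "x \<in> \<Union>(G i)" "x \<in> \<Union>(G j)" by (auto simp: G_def)
    then show ?thesis by (metis linorder_neqE_nat less_imp_le)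
  qed
  ultimately show ?thesis by (metis le_neq_implies_less)
qed

text \<open>Each member of the sparser family \<open>G\<close> absorbs the members of \<open>F\<close> close to it.\<close>

lemma ex_saturated_union:
  fixes F G :: "'a::metric_space set set"
  assumes F: "coarse_family R D F" and G: "coarse_family (3 * R + 2 * D) E G"
    and "0 < R" "0 \<le> D" "0 \<le> E"
  shows "\<exists>H. coarse_family R (E + 2 * (R + D)) H \<and> \<Union>H = \<Union>F \<union> \<Union>G"
proof -
  define near where "near U V \<longleftrightarrow> (\<exists>u\<in>U. \<exists>v\<in>V. dist u v < R)" for U V :: "'a set"
  define sat where "sat V = V \<union> \<Union>{U \<in> F. near U V}" for V
  define H where "H = sat ` G \<union> {U \<in> F. \<forall>V\<in>G. \<not> near U V}"
  have sat_close: "\<exists>v\<in>V. dist x v < R + D" if x: "x \<in> sat V" for x V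
  proof (cases "x \<in> V")
    case True
    then show ?thesis using assms(3,4) by (intro bexI[of _ x]) auto
  next
    case False
    then obtain U where "U \<in> F" "x \<in> U" "near U V" using x by (auto simp: sat_def)
    then obtain u v where U: "U \<in> F" "x \<in> U" "u \<in> U" "v \<in> V" "dist u v < R"
      unfolding near_def by blast
    then have "dist x u \<le> D" using coarse_family_bounded[OF F] by blast
    then have "dist x v < R + D" using U(5) dist_triangle[of x v u] by linarith
    then show ?thesis using U(4) by blast
  qed
  \<comment> \<open>A member of \<open>F\<close> near no member of \<open>G\<close> stays unchanged.
    A point of \<open>\<Union>H\<close> within \<open>R\<close> of it can only come from
    \<open>F\<close>, whose separation puts it into that same member.\<close>
  have isolated: "y \<in> U" if U: "U \<in> F" "\<And>V. V \<in> G \<Longrightarrow> \<not> near U V" "V \<in> H"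
    "x \<in> U" "y \<in> V" "dist x y < R" for U V x y
  proof -
    have "y \<notin> W" if "W \<in> G" for W using U(2)[OF that] U(4,6) by (auto simp: near_def)
    then have "\<exists>U'\<in>F. y \<in> U'" using U(3,5) unfolding H_def sat_def by blast
    then show ?thesis using coarse_family_eq[OF F] U by blast
  qed
  have "coarse_family R (E + 2 * (R + D)) H"
  proof (rule coarse_familyI)
    fix V x y assume V: "V \<in> H" "x \<in> V" "y \<in> V"
    then consider W where "W \<in> G" "V = sat W" | "V \<in> F" by (auto simp: H_def)
    then show "dist x y \<le> E + 2 * (R + D)"
    proof cases
      case 1
      then obtain v w where vw: "v \<in> W" "w \<in> W" "dist x v < R + D" "dist y w < R + D"
        using sat_close V by metis
      then have "dist v w \<le> E" using coarse_family_bounded[OF G] 1 by blast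
      then show ?thesis
        using vw dist_triangle[of x y v] dist_triangle[of v y w] by (simp add: dist_commute)
    next
      case 2
      then show ?thesis using coarse_family_bounded[OF F 2, of x y] V assms(3-5) by simp
    qed
  next
    fix V V' x y assume V: "V \<in> H" "V' \<in> H" "x \<in> V" "y \<in> V'" and xy: "dist x y < R"
    show "V = V'"
    proof (cases "\<exists>W\<in>G. \<exists>W'\<in>G. V = sat W \<and> V' = sat W'")
      case True
      then obtain W W' v w where W: "W \<in> G" "W' \<in> G" "V = sat W" "V' = sat W'"
        "v \<in> W" "w \<in> W'" "dist x v < R + D" "dist y w < R + D"
        using sat_close V by metis
      \<comment> \<open>Two steps of length \<open>R + D\<close> to the cores and one of length
        \<open>R\<close> between the points: this explains the separation demanded of
        \<open>G\<close>.\<close>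
      then have "dist v w < 3 * R + 2 * D"
        using xy dist_triangle[of v w x] dist_triangle[of x w y] by (simp add: dist_commute)
      then show ?thesis using coarse_family_eq[OF G] W by blast
    next
      case False
      \<comment> \<open>No saturated set comes within \<open>R\<close> of an isolated
        \<open>A\<close>: the point \<open>a'\<close> would lie in a member of \<open>G\<close>, or
        in an absorbed member of \<open>F\<close>, which would be \<open>A\<close> itself.\<close>
      have *: "A = A'" if A: "A \<in> F" "\<And>W. W \<in> G \<Longrightarrow> \<not> near A W" "A' \<in> H"
        "a \<in> A" "a' \<in> A'" "dist a a' < R" for A A' a a'
      proof -
        have a': "a' \<in> A" using isolated[OF A] .
        have no: "A' \<noteq> sat W" if "W \<in> G" for W
        proof
          assume "A' = sat W"
          then consider "a' \<in> W" | U where "U \<in> F" "near U W" "a' \<in> U"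
            using \<open>a' \<in> A'\<close> by (auto simp: sat_def)
          then show False
          proof cases
            case 1
            then show False using A(2)[OF that] a' assms(3) by (force simp: near_def)
          next
            case 2
            then have "U = A" using coarse_family_eq[OF F, of U A a' a'] A(1) a' assms(3) by simp
            then show False using 2 A(2)[OF that] by simp
          qed
        qed
        then have "A' \<in> F" using A(3) by (auto simp: H_def)
        then show ?thesis using coarse_family_eq[OF F, of A A' a' a'] A a' assms(3) by simp
      qed
      from False V(1,2) consider "V \<in> F" "\<And>W. W \<in> G \<Longrightarrow> \<not> near V W"
        | "V' \<in> F" "\<And>W. W \<in> G \<Longrightarrow> \<not> near V' W"
        by (auto simp: H_def)
      then show ?thesis
      proof cases
        case 1
        then show ?thesis using *[of V V' x y] V xy by blast
      next
        case 2
        then show ?thesis using *[of V' V y x] V xy by (metis dist_commute)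
      qed
    qed
  qed
  moreover have "\<Union>H = \<Union>F \<union> \<Union>G"
    by (auto simp: H_def sat_def)
  ultimately show ?thesis by blast
qed

lemma coarse_family_mono:
  "coarse_family R D F \<Longrightarrow> D \<le> D' \<Longrightarrow> coarse_family R D' F"
  unfolding coarse_family_def by (meson order_trans)

text \<open>One bound \<open>D\<close> serves all strips of a given width, so infinitely many pieces
  can be glued with a common bound. As \<open>h\<close> is 1-Lipschitz, gaps between its values are
  gaps between points.\<close>

lemma ex_coloured_cover_over_line:
  fixes h :: "'a::metric_space \<Rightarrow> real" and N :: nat
  assumes lip: "\<And>x y. \<bar>h x - h y\<bar> \<le> dist x y"
    and strips: "\<And>R w. 0 < R \<Longrightarrow> 0 < w \<Longrightarrow> \<exists>D. \<forall>t. \<exists>F. (\<forall>i<N. coarse_family R D (F i)) \<and>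
      {x. t \<le> h x \<and> h x < t + w} \<subseteq> (\<Union>i<N. \<Union>(F i))"
    and R: "0 < R"
  shows "\<exists>D (F :: nat \<Rightarrow> 'a set set). (\<forall>i\<le>N. coarse_family R D (F i)) \<and> (\<forall>x. \<exists>i\<le>N. x \<in> \<Union>(F i))"
proof -
  \<comment> \<open>A period has as many levels as there are colours, so each level is omitted by
    exactly one colour.\<close>
  define M where "M = int (Suc N)"
  have M: "0 < M" by (simp add: M_def)
  define lev where "lev x = \<lfloor>h x / R\<rfloor>" for x
  define ann where "ann q = {x. lev x div M = q}" for q
  have ann_strip: "ann q \<subseteq> {x. q * M * R \<le> h x \<and> h x < q * M * R + M * R}" for q
  proof
    fix x assume "x \<in> ann q"
    then have "q * M \<le> lev x" "lev x < q * M + M"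
      using div_mult_mod_eq[of "lev x" M] pos_mod_sign[OF M, of "lev x"] pos_mod_bound[OF M, of "lev x"]
      by (auto simp: ann_def)
    then have "real_of_int (q * M) \<le> h x / R" "h x / R < real_of_int (q * M + M)"
      by (auto simp: lev_def le_floor_iff floor_less_iff)
    then show "x \<in> {x. q * M * R \<le> h x \<and> h x < q * M * R + M * R}"
      using R by (simp add: field_simps)
  qed
  \<comment> \<open>The bound is independent of \<open>q\<close>; it is made nonnegative because the
    saturated union asks for that.\<close>
  have annuli: "\<exists>D\<ge>0. \<forall>q. \<exists>G. (\<forall>i\<le>N. coarse_family S D (G i)) \<and>
      (\<forall>x\<in>ann q. \<exists>i j. i < j \<and> j \<le> N \<and> x \<in> \<Union>(G i) \<and> x \<in> \<Union>(G j))" if S: "0 < S" for S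
  proof -
    have "0 < 3 * S" "0 < M * R" using S R M by auto
    from strips[OF this] obtain D where D: "\<And>t. \<exists>F. (\<forall>i<N. coarse_family (3 * S) D (F i)) \<and>
      {x. t \<le> h x \<and> h x < t + M * R} \<subseteq> (\<Union>i<N. \<Union>(F i))" by blast
    have "\<exists>G. (\<forall>i\<le>N. coarse_family S (max 0 (D + 2 * S)) (G i)) \<and>
      (\<forall>x\<in>ann q. \<exists>i j. i < j \<and> j \<le> N \<and> x \<in> \<Union>(G i) \<and> x \<in> \<Union>(G j))" for q
    proof -
      obtain F where F: "\<forall>i<N. coarse_family (3 * S) D (F i)"
        "{x. q * M * R \<le> h x \<and> h x < q * M * R + M * R} \<subseteq> (\<Union>i<N. \<Union>(F i))"
        using D[of "q * M * R"] by iprover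
      obtain G where G: "\<forall>i\<le>N. coarse_family S (D + 2 * S) (G i)"
        "\<forall>x\<in>ann q. \<exists>i j. i < j \<and> j \<le> N \<and> x \<in> \<Union>(G i) \<and> x \<in> \<Union>(G j)"
        using ex_doubly_covering_families[OF F(1) S order_trans[OF ann_strip F(2)]]
        by iprover
      have "\<forall>i\<le>N. coarse_family S (max 0 (D + 2 * S)) (G i)"
        using G(1) by (intro allI impI coarse_family_mono[OF _ max.cobounded2]) simp
      then show ?thesis using G(2) by (intro exI[of _ G] conjI)
    qed
    then show ?thesis by (intro exI[of _ "max 0 (D + 2 * S)"]) simp
  qed
  obtain D G where D: "0 \<le> D" and G: "\<And>q i. i \<le> N \<Longrightarrow> coarse_family R D (G q i)"
    "\<And>q x. x \<in> ann q \<Longrightarrow> \<exists>i j. i < j \<and> j \<le> N \<and> x \<in> \<Union>(G q i) \<and> x \<in> \<Union>(G q j)"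
    using annuli[OF R] by metis
  \<comment> \<open>The second families are built only once \<open>D\<close> is known, since their
    separation must dominate it.\<close>
  have "0 < 3 * R + 2 * D" using R D by simp
  then obtain E H where E: "0 \<le> E" and H: "\<And>q i. i \<le> N \<Longrightarrow> coarse_family (3 * R + 2 * D) E (H q i)"
    "\<And>q x. x \<in> ann q \<Longrightarrow> \<exists>i j. i < j \<and> j \<le> N \<and> x \<in> \<Union>(H q i) \<and> x \<in> \<Union>(H q j)"
    using annuli by metis
  \<comment> \<open>Even strips get the finer scale, odd strips the coarser one, so adjacent strips can be merged.\<close>
  define A where "A q = (if even q then G q else H q)" for q
  have A: "\<exists>i j. i < j \<and> j \<le> N \<and> x \<in> \<Union>(A q i) \<and> x \<in> \<Union>(A q j)" if "x \<in> ann q" for x q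
    using G(2) H(2) that by (auto simp: A_def)
  have ex_J: "\<exists>J. coarse_family R (E + 2 * (R + D)) J \<and> \<Union>J = \<Union>(A q i) \<union> \<Union>(A (q + 1) i)" if "i \<le> N" for q i
    using ex_saturated_union[OF G(1) H(1) R D E, OF that that, of q "q + 1"]
      ex_saturated_union[OF G(1) H(1) R D E, OF that that, of "q + 1" q]
    by (cases "even q") (auto simp: A_def Un_commute)
  define J where "J q i = (SOME J. coarse_family R (E + 2 * (R + D)) J \<and>
      \<Union>J = \<Union>(A q i) \<union> \<Union>(A (q + 1) i))" for q i
  have "coarse_family R (E + 2 * (R + D)) (J q i) \<and> \<Union>(J q i) = \<Union>(A q i) \<union> \<Union>(A (q + 1) i)"
    if "i \<le> N" for q i
    unfolding J_def by (rule someI_ex) (rule ex_J[OF that])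
  then have J: "\<And>q i. i \<le> N \<Longrightarrow> coarse_family R (E + 2 * (R + D)) (J q i)"
    "\<And>q i. i \<le> N \<Longrightarrow> \<Union>(J q i) = \<Union>(A q i) \<union> \<Union>(A (q + 1) i)"
    by simp_all
  \<comment> \<open>A block lies strictly between two consecutive levels omitted by colour
    \<open>i\<close>, hence inside \<open>ann q\<close> and \<open>ann (q + 1)\<close>;
    \<open>J q i\<close> merges just these two.\<close>
  define blk where "blk q i = {x. q * M + int i < lev x \<and> lev x < (q + 1) * M + int i}" for q i
  define F where "F i = (\<Union>q. (\<lambda>U. U \<inter> blk q i) ` J q i)" for i
  have blk_eq: "q = q'" if "x \<in> blk q i" "y \<in> blk q' i" "dist x y < R" for q q' i x y
  proof -
    have less: False if "p < p'" "u \<in> blk p i" "v \<in> blk p' i" "dist u v < R" for p p' u v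
    proof -
      have "(p + 1) * M \<le> p' * M" using that(1) M by (intro mult_right_mono) auto
      \<comment> \<open>An omitted level separates the blocks, so the levels differ by at least 2
        and \<open>h\<close> by at least one full level width \<open>R\<close>.\<close>
      then have "lev u + 2 \<le> lev v" using that(2,3) unfolding blk_def mem_Collect_eq by linarith
      then have "h u / R + 1 \<le> h v / R" unfolding lev_def by linarith
      then have "(h u + R) / R \<le> h v / R" using R by (simp add: add_divide_distrib)
      then have "R \<le> h v - h u" using R by (simp add: divide_le_cancel)
      then show False using lip[of u v] that(4) by linarith
    qed
    show ?thesis using less[of q q' x y] less[of q' q y x] that by (metis dist_commute linorder_neqE)
  qed
  have "coarse_family R (E + 2 * (R + D)) (F i)" if "i \<le> N" for i
  proof (rule coarse_familyI)
    fix U x y assume "U \<in> F i" "x \<in> U" "y \<in> U"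
    then show "dist x y \<le> E + 2 * (R + D)"
      using coarse_family_bounded[OF J(1)[OF that]] by (auto simp: F_def)
  next
    fix U V x y assume UV: "U \<in> F i" "V \<in> F i" "x \<in> U" "y \<in> V" "dist x y < R"
    then obtain q q' U' V' where *: "U = U' \<inter> blk q i" "V = V' \<inter> blk q' i" "U' \<in> J q i" "V' \<in> J q' i"
      by (auto simp: F_def)
    then have "q = q'" using blk_eq UV by blast
    then show "U = V" using coarse_family_eq[OF J(1)[OF that], of U' q V' x y] * UV by blast
  qed
  moreover have "\<exists>i\<le>N. x \<in> \<Union>(F i)" for x
  proof -
    define q \<rho> where "q = lev x div M" and "\<rho> = lev x mod M"
    have lev: "lev x = q * M + \<rho>" "0 \<le> \<rho>" "\<rho> < M"
      using M by (auto simp: q_def \<rho>_def)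
    have "x \<in> ann q" by (simp add: ann_def q_def)
    \<comment> \<open>At most one of the two colours equals the residue \<open>\<rho>\<close>; the
      other one does not omit the level of \<open>x\<close>.\<close>
    then obtain i where i: "i \<le> N" "x \<in> \<Union>(A q i)" "int i \<noteq> \<rho>"
      using A by (metis less_imp_le_nat less_le_trans of_nat_eq_iff order_less_irrefl)
    have "int i < M" using i(1) by (simp add: M_def)
    show ?thesis
    proof (cases "int i < \<rho>")
      case True
      then have "x \<in> blk q i" using lev by (simp add: blk_def algebra_simps)
      moreover have "x \<in> \<Union>(J q i)" using i J(2)[OF i(1), of q] by simp
      ultimately show ?thesis using i(1) unfolding F_def by blast
    next
      \<comment> \<open>The residue lies below \<open>i\<close>, so the block containing
        \<open>x\<close> began in the previous period.\<close>
      case False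
      have "x \<in> blk (q - 1) i \<longleftrightarrow> q * M - M + int i < lev x \<and> lev x < q * M + int i"
        by (simp add: blk_def left_diff_distrib)
      then have "x \<in> blk (q - 1) i" using lev i(3) False \<open>int i < M\<close> by simp
      moreover have "x \<in> \<Union>(J (q - 1) i)" using i J(2)[OF i(1), of "q - 1"] by simp
      ultimately show ?thesis using i(1) unfolding F_def by blast
    qed
  qed
  ultimately show ?thesis by blast
qed

section \<open>Capacity dimension\<close>

text \<open>The outer lower limit fixes one \<open>\<delta>\<close>; the inner one then yields a
  single \<open>c\<close> valid at all small scales, and the supremum yields the covers.\<close>

lemma c_cap_posE:
  assumes "c_cap Z d m > 0"
  obtains c \<delta> \<tau>\<^sub>0 :: real where "0 < c" "0 < \<delta>" "0 < \<tau>\<^sub>0"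
    "\<And>\<tau>. 0 < \<tau> \<Longrightarrow> \<tau> < \<tau>\<^sub>0 \<Longrightarrow> \<exists>U. open_cover Z d U \<and> colored (m + 1) U \<and>
      ereal (\<delta> * \<tau>) \<le> mesh d U \<and> mesh d U \<le> ereal \<tau> \<and> ereal c < capacity Z d U"
proof -
  have "eventually (\<lambda>\<delta>. 0 < c_delta Z d m \<delta>) (at_right 0)"
    using assms unfolding c_cap_def by (rule less_LiminfD)
  then obtain \<delta>\<^sub>1 where \<delta>\<^sub>1: "0 < \<delta>\<^sub>1" "\<And>\<delta>. 0 < \<delta> \<Longrightarrow> \<delta> < \<delta>\<^sub>1 \<Longrightarrow> 0 < c_delta Z d m \<delta>"
    by (auto simp: eventually_at_right_field)
  define \<delta> where "\<delta> = \<delta>\<^sub>1 / 2"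
  have \<delta>: "0 < \<delta>" "0 < c_delta Z d m \<delta>" using \<delta>\<^sub>1 by (auto simp: \<delta>_def)
  then obtain c where c: "0 < ereal c" "ereal c < c_delta Z d m \<delta>" using ereal_dense2 by blast
  then have "eventually (\<lambda>\<tau>. ereal c < c_tau Z d \<tau> m \<delta>) (at_right 0)"
    unfolding c_delta_def by (intro less_LiminfD)
  then obtain \<tau>\<^sub>0 where \<tau>\<^sub>0: "0 < \<tau>\<^sub>0" "\<And>\<tau>. 0 < \<tau> \<Longrightarrow> \<tau> < \<tau>\<^sub>0 \<Longrightarrow> ereal c < c_tau Z d \<tau> m \<delta>"
    by (auto simp: eventually_at_right_field)
  show thesis
  proof (rule that)
    fix \<tau> :: real assume "0 < \<tau>" "\<tau> < \<tau>\<^sub>0"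
    then have "ereal c < c_tau Z d \<tau> m \<delta>" by (rule \<tau>\<^sub>0(2))
    then show "\<exists>U. open_cover Z d U \<and> colored (m + 1) U \<and>
      ereal (\<delta> * \<tau>) \<le> mesh d U \<and> mesh d U \<le> ereal \<tau> \<and> ereal c < capacity Z d U"
      unfolding c_tau_def less_SUP_iff by blast
  qed (use c \<delta> \<tau>\<^sub>0 in auto)
qed

lemma dist_le_mesh: "V \<in> U \<Longrightarrow> x \<in> V \<Longrightarrow> y \<in> V \<Longrightarrow> ereal (d x y) \<le> mesh d U"
proof -
  assume "V \<in> U" "x \<in> V" "y \<in> V"
  then have "ereal (d x y) \<le> ediam d V" unfolding ediam_def by (intro Sup_upper) auto
  also have "\<dots> \<le> mesh d U" unfolding mesh_def using \<open>V \<in> U\<close> by (intro Sup_upper) auto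
  finally show ?thesis .
qed

text \<open>The members of a colour of a covering with large Lebesgue number are shrunk by the Lebesgue
  number: the result still covers, and disjointness becomes separation.\<close>

lemma ex_separated_cover_if_c_cap_pos:
  assumes "metric_on Z d" and "c_cap Z d m > 0"
  obtains \<kappa> \<tau>\<^sub>0 :: real where "0 < \<kappa>" "0 < \<tau>\<^sub>0"
    "\<And>\<tau>. 0 < \<tau> \<Longrightarrow> \<tau> < \<tau>\<^sub>0 \<Longrightarrow> \<exists>G.
      (\<forall>i\<le>m. \<forall>V\<in>G i. \<forall>x\<in>V. \<forall>y\<in>V. d x y \<le> \<tau>) \<and>
      (\<forall>i\<le>m. \<forall>V\<in>G i. \<forall>W\<in>G i. V \<noteq> W \<longrightarrow> (\<forall>x\<in>V. \<forall>y\<in>W. \<kappa> * \<tau> \<le> d x y)) \<and>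
      Z \<subseteq> (\<Union>i\<le>m. \<Union>(G i))"
proof -
  obtain c \<delta> \<tau>\<^sub>0 :: real where pos: "0 < c" "0 < \<delta>" "0 < \<tau>\<^sub>0"
    and U: "\<And>\<tau>. 0 < \<tau> \<Longrightarrow> \<tau> < \<tau>\<^sub>0 \<Longrightarrow> \<exists>U. open_cover Z d U \<and> colored (m + 1) U \<and>
      ereal (\<delta> * \<tau>) \<le> mesh d U \<and> mesh d U \<le> ereal \<tau> \<and> ereal c < capacity Z d U"
    using c_cap_posE[OF assms(2)] by metis
  \<comment> \<open>The Lebesgue number exceeds \<open>c\<close> times the mesh, and the mesh is at
    least \<open>\<delta> * \<tau>\<close>.\<close>
  define \<kappa> where "\<kappa> = c * \<delta>"
  have \<kappa>: "0 < \<kappa>" using pos by (simp add: \<kappa>_def)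
  have "\<exists>G. (\<forall>i\<le>m. \<forall>V\<in>G i. \<forall>x\<in>V. \<forall>y\<in>V. d x y \<le> \<tau>) \<and>
    (\<forall>i\<le>m. \<forall>V\<in>G i. \<forall>W\<in>G i. V \<noteq> W \<longrightarrow> (\<forall>x\<in>V. \<forall>y\<in>W. \<kappa> * \<tau> \<le> d x y)) \<and>
    Z \<subseteq> (\<Union>i\<le>m. \<Union>(G i))" if \<tau>: "0 < \<tau>" "\<tau> < \<tau>\<^sub>0" for \<tau>
  proof -
    obtain U where U: "open_cover Z d U" "colored (m + 1) U"
      "ereal (\<delta> * \<tau>) \<le> mesh d U" "mesh d U \<le> ereal \<tau>" "ereal c < capacity Z d U"
      using U[OF \<tau>] by blast
    obtain F where F: "U = (\<Union>i<m + 1. F i)"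
      "\<And>i V W. i < m + 1 \<Longrightarrow> V \<in> F i \<Longrightarrow> W \<in> F i \<Longrightarrow> V \<noteq> W \<Longrightarrow> V \<inter> W = {}"
      using U(2) unfolding colored_def by blast
    obtain \<mu> where \<mu>: "mesh d U = ereal \<mu>" "\<delta> * \<tau> \<le> \<mu>"
      using U(3,4) by (cases "mesh d U") auto
    \<comment> \<open>A positive finite mesh rules out the default value 1 of
      \<open>capacity\<close>.\<close>
    have "0 < \<mu>" using \<mu>(2) pos \<tau> by (smt (verit) mult_pos_pos)
    then have "ereal c < leb Z d U / ereal \<mu>"
      using U(5) by (simp add: capacity_def \<mu>(1) zero_ereal_def)
    then have "ereal (c * \<mu>) < leb Z d U"
      using \<open>0 < \<mu>\<close> by (simp add: ereal_less_divide_pos mult.commute)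
    moreover have "\<kappa> * \<tau> \<le> c * \<mu>" using \<mu>(2) pos by (simp add: \<kappa>_def mult.assoc)
    ultimately have leb: "ereal (\<kappa> * \<tau>) < leb Z d U"
      using ereal_less_eq(3) order_le_less_trans by blast
    define shr where "shr V = {z \<in> V. \<forall>w\<in>Z - V. \<kappa> * \<tau> \<le> d z w}" for V
    have sub: "V \<subseteq> Z" if "V \<in> U" for V using U(1) that by (auto simp: open_cover_def)
    have "d x y \<le> \<tau>" if "i \<le> m" "V \<in> F i" "x \<in> shr V" "y \<in> shr V" for i V x y
    proof -
      have "ereal (d x y) \<le> mesh d U"
        using that by (intro dist_le_mesh[of V]) (auto simp: F(1) shr_def intro!: bexI[of _ i])
      then show ?thesis using U(4) by (meson ereal_less_eq(3) order_trans)
    qed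
    moreover have "\<kappa> * \<tau> \<le> d x y"
      if "i \<le> m" "V \<in> F i" "W \<in> F i" "V \<noteq> W" "x \<in> shr V" "y \<in> shr W" for i V W x y
    proof -
      have "y \<notin> V" using F(2)[of i V W] that by (auto simp: shr_def)
      moreover have "y \<in> Z" using that sub[of W] unfolding F(1) shr_def by fastforce
      ultimately show ?thesis using that by (auto simp: shr_def)
    qed
    moreover have "\<exists>i\<le>m. \<exists>V\<in>F i. z \<in> shr V" if "z \<in> Z" for z
    proof -
      have "leb Z d U \<le> (SUP V\<in>U. dist_compl Z d z V)"
        unfolding leb_def using that by (intro INF_lower2[of z]) (auto simp: leb_at_def)
      then have "ereal (\<kappa> * \<tau>) < (SUP V\<in>U. dist_compl Z d z V)" using leb by simp
      then obtain V where V: "V \<in> U" "ereal (\<kappa> * \<tau>) < dist_compl Z d z V"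
        by (auto simp: less_SUP_iff)
      have far: "\<kappa> * \<tau> \<le> d z w" if "w \<in> Z - V" for w
      proof -
        have "dist_compl Z d z V \<le> ereal (d z w)"
          unfolding dist_compl_def using that by (intro INF_lower)
        then have "ereal (\<kappa> * \<tau>) < ereal (d z w)" using V(2) by (rule order_less_le_trans[rotated])
        then show ?thesis by simp
      qed
      \<comment> \<open>Were \<open>z\<close> outside \<open>V\<close>, it would be a point of
        \<open>Z - V\<close> at distance 0 from itself.\<close>
      have "d z z = 0" using assms(1) that by (auto simp: metric_on_def)
      then have "z \<in> V" using far[of z] that \<kappa> \<tau> by (smt (verit) Diff_iff mult_pos_pos)
      then have "z \<in> shr V" using far by (simp add: shr_def)
      then show ?thesis using V(1) by (auto simp: F(1) less_Suc_eq_le)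
    qed
    ultimately show ?thesis
      by (intro exI[of _ "\<lambda>i. shr ` F i"]) (fastforce simp: Ball_def)
  qed
  with \<kappa> pos(3) show thesis by (rule that)
qed

section \<open>Visual hyperbolic spaces\<close>

lemma gromov_prod_change_base: "gromov_prod p x y \<le> gromov_prod q x y + dist p q"
  using dist_triangle[of x p q] dist_triangle[of y p q]
  by (simp add: gromov_prod_def dist_commute field_simps)

lemma gromov_prod_commute: "gromov_prod p x y = gromov_prod p y x"
  by (simp add: gromov_prod_def dist_commute)

lemma gromov_prod_le_dist: "gromov_prod p x y \<le> dist x p"
  using dist_triangle[of y p x] by (simp add: gromov_prod_def dist_commute)

lemma boundary_point_nonempty:
  assumes "\<xi> \<in> boundary b"
  shows "\<xi> \<noteq> {}"
proof -
  obtain s where s: "conv_infty b s" "\<xi> = {s'. conv_infty b s' \<and> seq_equiv b s s'}"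
    using assms by (auto simp: boundary_def)
  have "seq_equiv b s s"
    using s(1) unfolding seq_equiv_def conv_infty_def filterlim_at_top eventually_sequentially by metis
  then show ?thesis using s by auto
qed

text \<open>Products at two base points differ by at most the distance of these points, so moving
  from \<open>q\<close> to \<open>p\<close> costs \<open>2 * dist p q\<close>.\<close>

lemma gromov_hyperbolicE:
  assumes "gromov_hyperbolic TYPE('a::metric_space)"
  obtains \<delta> where "0 \<le> \<delta>"
    "\<And>x y z. min (gromov_prod p x y) (gromov_prod p y z) - \<delta> \<le> gromov_prod (p::'a) x z"
proof -
  obtain \<delta> and q :: 'a where \<delta>: "0 \<le> \<delta>"
    and hyp: "\<And>x y z. min (gromov_prod q x y) (gromov_prod q y z) - \<delta> \<le> gromov_prod q x z"
    using assms unfolding gromov_hyperbolic_def by blast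
  show thesis
  proof (rule that)
    fix x y z
    show "min (gromov_prod p x y) (gromov_prod p y z) - (\<delta> + 2 * dist p q) \<le> gromov_prod p x z"
      using hyp[of x y z] gromov_prod_change_base[of p x y q] gromov_prod_change_base[of p y z q]
        gromov_prod_change_base[of q x z p]
      by (simp add: dist_commute)
  qed (use \<delta> in simp)
qed

lemma eventually_gromov_prod_gt:
  assumes "ereal (h - D) \<le> gromov_prod_pt_bdry p x \<xi>" "s \<in> \<xi>"
  shows "eventually (\<lambda>i. h - D - 1 < gromov_prod p x (s i)) sequentially"
proof -
  \<comment> \<open>Only values strictly below the lower limit are sure to be exceeded eventually;
    hence the loss of 1.\<close>
  have "ereal (h - D - 1) < ereal (h - D)" by simp
  also have "\<dots> \<le> liminf (\<lambda>i. ereal (gromov_prod p x (s i)))"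
    using assms(1) INF_lower[OF assms(2)] unfolding gromov_prod_pt_bdry_def by (rule order_trans)
  finally show ?thesis using less_LiminfD by fastforce
qed

text \<open>Sending a point to a boundary point that it nearly looks towards preserves Gromov products
  up to a bounded error and up to truncation at the distances from the base point.\<close>

lemma ex_boundary_projection:
  fixes b :: "'a::metric_space"
  assumes "gromov_hyperbolic TYPE('a)" and "visual_space b"
  shows "\<exists>x\<^sub>0 (\<pi> :: 'a \<Rightarrow> (nat \<Rightarrow> 'a) set) C. (\<forall>x. \<pi> x \<in> boundary b) \<and>
    (\<forall>x y. ereal (gromov_prod x\<^sub>0 x y - C) \<le> gromov_prod_bdry p (\<pi> x) (\<pi> y)) \<and>
    (\<forall>x y t. ereal t \<le> gromov_prod_bdry p (\<pi> x) (\<pi> y) \<longrightarrow>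
       min t (min (dist x x\<^sub>0) (dist y x\<^sub>0)) - C \<le> gromov_prod x\<^sub>0 x y)"
proof -
  obtain x\<^sub>0 :: 'a and D where D: "0 < D"
    "\<And>x. \<exists>\<xi>\<in>boundary b. ereal (dist x x\<^sub>0) \<le> gromov_prod_pt_bdry x\<^sub>0 x \<xi> + ereal D"
    using assms(2) unfolding visual_space_def by blast
  have "\<exists>\<xi>\<in>boundary b. ereal (dist x x\<^sub>0 - D) \<le> gromov_prod_pt_bdry x\<^sub>0 x \<xi>" for x
  proof -
    obtain \<xi> where "\<xi> \<in> boundary b" "ereal (dist x x\<^sub>0) \<le> gromov_prod_pt_bdry x\<^sub>0 x \<xi> + ereal D"
      using D(2) by blast
    then show ?thesis by (cases "gromov_prod_pt_bdry x\<^sub>0 x \<xi>") (auto intro!: bexI[of _ \<xi>])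
  qed
  then obtain \<pi> where \<pi>: "\<And>x. \<pi> x \<in> boundary b"
    "\<And>x. ereal (dist x x\<^sub>0 - D) \<le> gromov_prod_pt_bdry x\<^sub>0 x (\<pi> x)"
    by metis
  note ev = eventually_gromov_prod_gt[OF \<pi>(2)]
  obtain \<delta> where \<delta>: "0 \<le> \<delta>"
    and hyp: "\<And>x y z. min (gromov_prod x\<^sub>0 x y) (gromov_prod x\<^sub>0 y z) - \<delta> \<le> gromov_prod x\<^sub>0 x z"
    using gromov_hyperbolicE[OF assms(1)] by metis
  define C where "C = 2 * \<delta> + D + 1 + dist p x\<^sub>0"
  have "ereal (gromov_prod x\<^sub>0 x y - C) \<le> gromov_prod_bdry p (\<pi> x) (\<pi> y)" for x y
    unfolding gromov_prod_bdry_def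
  proof (rule INF_greatest)
    fix q assume "q \<in> \<pi> x \<times> \<pi> y"
    then have "fst q \<in> \<pi> x" "snd q \<in> \<pi> y" by auto
    from ev[OF this(1)] ev[OF this(2)]
    have "eventually (\<lambda>i. gromov_prod x\<^sub>0 x y - C \<le> gromov_prod p (fst q i) (snd q i)) sequentially"
    proof eventually_elim
      case (elim i)
      \<comment> \<open>Hyperbolicity is used along the chain \<open>?u\<close>, \<open>x\<close>,
        \<open>y\<close>, \<open>?v\<close>.\<close>
      let ?u = "fst q i" and ?v = "snd q i"
      show ?case
        using elim hyp[of ?u x y] hyp[of ?u y ?v] gromov_prod_change_base[of x\<^sub>0 ?u ?v p] \<delta>
          gromov_prod_le_dist[of x\<^sub>0 x y] gromov_prod_le_dist[of x\<^sub>0 y x] D(1) zero_le_dist[of p x\<^sub>0]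
        by (simp add: C_def gromov_prod_commute[of _ y x] gromov_prod_commute[of _ ?u x] dist_commute)
    qed
    then show "ereal (gromov_prod x\<^sub>0 x y - C) \<le> liminf (\<lambda>i. ereal (gromov_prod p (fst q i) (snd q i)))"
      by (intro Liminf_bounded) simp
  qed
  moreover have "min t (min (dist x x\<^sub>0) (dist y x\<^sub>0)) - C \<le> gromov_prod x\<^sub>0 x y"
    if t: "ereal t \<le> gromov_prod_bdry p (\<pi> x) (\<pi> y)" for x y t
  proof -
    obtain u v where uv: "u \<in> \<pi> x" "v \<in> \<pi> y"
      using boundary_point_nonempty \<pi>(1) by blast
    have "ereal (t - 1) < ereal t" by simp
    also have "ereal t \<le> liminf (\<lambda>i. ereal (gromov_prod p (u i) (v i)))"
      using t INF_lower[of "(u, v)" "\<pi> x \<times> \<pi> y" "\<lambda>q. liminf (\<lambda>i. ereal (gromov_prod p (fst q i) (snd q i)))"]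
        uv by (simp add: gromov_prod_bdry_def)
    finally have "eventually (\<lambda>i. t - 1 < gromov_prod p (u i) (v i)) sequentially"
      using less_LiminfD by fastforce
    then have "eventually (\<lambda>i. t - 1 < gromov_prod p (u i) (v i) \<and>
      dist x x\<^sub>0 - D - 1 < gromov_prod x\<^sub>0 x (u i) \<and> dist y x\<^sub>0 - D - 1 < gromov_prod x\<^sub>0 y (v i)) sequentially"
      using ev[OF uv(1)] ev[OF uv(2)] by eventually_elim simp
    then obtain i where i: "t - 1 < gromov_prod p (u i) (v i)"
      "dist x x\<^sub>0 - D - 1 < gromov_prod x\<^sub>0 x (u i)" "dist y x\<^sub>0 - D - 1 < gromov_prod x\<^sub>0 y (v i)"
      using eventually_happens by fastforce
    \<comment> \<open>The chain is now \<open>x\<close>, \<open>u i\<close>, \<open>v i\<close>,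
      \<open>y\<close>.\<close>
    then show ?thesis
      using hyp[of x "u i" y] hyp[of "u i" "v i" y] gromov_prod_change_base[of p "u i" "v i" x\<^sub>0] \<delta> D(1)
        zero_le_dist[of p x\<^sub>0] gromov_prod_commute[of x\<^sub>0 y "v i"]
      unfolding C_def by linarith
  qed
  ultimately show ?thesis using \<pi>(1) by blast
qed

text \<open>Exponentiation turns additive errors of Gromov products into factors, so one error is
  absorbed in \<open>k\<^sub>2\<close>.\<close>

lemma ex_visual_projection:
  fixes b :: "'a::metric_space"
  assumes "gromov_hyperbolic TYPE('a)" and "visual_space b" and "visual_metric b d"
  obtains a k\<^sub>1 k\<^sub>2 \<pi> and x\<^sub>0 :: 'a and C where "1 < a" "0 < k\<^sub>1" "0 < k\<^sub>2" "\<And>x. \<pi> x \<in> boundary b"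
    "\<And>x y. d (\<pi> x) (\<pi> y) \<le> k\<^sub>2 * a powr - gromov_prod x\<^sub>0 x y"
    "\<And>x y t. d (\<pi> x) (\<pi> y) \<le> k\<^sub>1 * a powr - t \<Longrightarrow>
       min t (min (dist x x\<^sub>0) (dist y x\<^sub>0)) - C \<le> gromov_prod x\<^sub>0 x y"
proof -
  obtain p :: 'a and a c\<^sub>1 c\<^sub>2 where a: "1 < a" "0 < c\<^sub>1" "0 < c\<^sub>2"
    and d: "\<And>\<xi> \<xi>'. \<xi> \<in> boundary b \<Longrightarrow> \<xi>' \<in> boundary b \<Longrightarrow>
        c\<^sub>1 * epowr_neg a (gromov_prod_bdry p \<xi> \<xi>') \<le> d \<xi> \<xi>' \<and>
        d \<xi> \<xi>' \<le> c\<^sub>2 * epowr_neg a (gromov_prod_bdry p \<xi> \<xi>')"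
    using assms(3) unfolding visual_metric_def by blast
  obtain x\<^sub>0 :: 'a and \<pi> C where \<pi>: "\<And>x. \<pi> x \<in> boundary b"
    and lower: "\<And>x y. ereal (gromov_prod x\<^sub>0 x y - C) \<le> gromov_prod_bdry p (\<pi> x) (\<pi> y)"
    and upper: "\<And>x y t. ereal t \<le> gromov_prod_bdry p (\<pi> x) (\<pi> y) \<Longrightarrow>
       min t (min (dist x x\<^sub>0) (dist y x\<^sub>0)) - C \<le> gromov_prod x\<^sub>0 x y"
    using ex_boundary_projection[OF assms(1,2), of p] by metis
  have near: "d (\<pi> x) (\<pi> y) \<le> (c\<^sub>2 * a powr C) * a powr - gromov_prod x\<^sub>0 x y" for x y
  proof -
    \<comment> \<open>Besides giving the bound, \<open>lower\<close> excludes minus infinity, where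
      \<open>epowr_neg\<close> takes the spurious value 1.\<close>
    have "epowr_neg a (gromov_prod_bdry p (\<pi> x) (\<pi> y)) \<le> a powr - (gromov_prod x\<^sub>0 x y - C)"
      using lower[of x y] a(1) by (cases "gromov_prod_bdry p (\<pi> x) (\<pi> y)") (auto simp: epowr_neg_def)
    then have "d (\<pi> x) (\<pi> y) \<le> c\<^sub>2 * a powr - (gromov_prod x\<^sub>0 x y - C)"
      using d[OF \<pi> \<pi>, of x y] a(3) by (meson mult_left_mono less_imp_le order_trans)
    then show ?thesis by (simp add: powr_diff powr_minus divide_simps)
  qed
  have far: "min t (min (dist x x\<^sub>0) (dist y x\<^sub>0)) - C \<le> gromov_prod x\<^sub>0 x y"
    if "d (\<pi> x) (\<pi> y) \<le> c\<^sub>1 * a powr - t" for x y t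
  proof (rule upper)
    have "c\<^sub>1 * epowr_neg a (gromov_prod_bdry p (\<pi> x) (\<pi> y)) \<le> c\<^sub>1 * a powr - t"
      using d[OF \<pi> \<pi>, of x y] that by linarith
    then have "epowr_neg a (gromov_prod_bdry p (\<pi> x) (\<pi> y)) \<le> a powr - t" using a(2) by simp
    then show "ereal t \<le> gromov_prod_bdry p (\<pi> x) (\<pi> y)"
      using lower[of x y] a(1) by (cases "gromov_prod_bdry p (\<pi> x) (\<pi> y)") (auto simp: epowr_neg_def)
  qed
  have "0 < c\<^sub>2 * a powr C" using a by simp
  from a(1,2) this \<pi> near far show thesis by (rule that)
qed

text \<open>Points of a strip with close projections have a large Gromov product and, having similar
  heights, are close; this bounds the preimages. Conversely, close points of the strip have close
  projections; this separates them.\<close>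

lemma ex_coloured_cover_of_strips:
  fixes b :: "'a::metric_space"
  assumes "gromov_hyperbolic TYPE('a)" and "visual_space b" and "visual_metric b d"
    and "c_cap (boundary b) d m > 0"
  shows "\<exists>x\<^sub>0::'a. \<forall>R>0. \<forall>w>0. \<exists>D. \<forall>t. \<exists>F. (\<forall>i<Suc m. coarse_family R D (F i)) \<and>
    {x. t \<le> dist x x\<^sub>0 \<and> dist x x\<^sub>0 < t + w} \<subseteq> (\<Union>i<Suc m. \<Union>(F i))"
proof -
  obtain a k\<^sub>1 k\<^sub>2 \<pi> and x\<^sub>0 :: 'a and C where a: "1 < a" "0 < k\<^sub>1" "0 < k\<^sub>2"
    and \<pi>: "\<And>x. \<pi> x \<in> boundary b"
    and near: "\<And>x y. d (\<pi> x) (\<pi> y) \<le> k\<^sub>2 * a powr - gromov_prod x\<^sub>0 x y"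
    and far: "\<And>x y t. d (\<pi> x) (\<pi> y) \<le> k\<^sub>1 * a powr - t \<Longrightarrow>
       min t (min (dist x x\<^sub>0) (dist y x\<^sub>0)) - C \<le> gromov_prod x\<^sub>0 x y"
    by (rule ex_visual_projection[OF assms(1-3)], rule that) assumption+
  have "metric_on (boundary b) d" using assms(3) by (simp add: visual_metric_def)
  note ex_cover = ex_separated_cover_if_c_cap_pos[OF this assms(4)]
  obtain \<kappa> \<tau>\<^sub>0 where pos: "0 < \<kappa>" "0 < \<tau>\<^sub>0"
    and sep: "\<And>\<tau>. 0 < \<tau> \<Longrightarrow> \<tau> < \<tau>\<^sub>0 \<Longrightarrow> \<exists>G.
      (\<forall>i\<le>m. \<forall>V\<in>G i. \<forall>x\<in>V. \<forall>y\<in>V. d x y \<le> \<tau>) \<and>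
      (\<forall>i\<le>m. \<forall>V\<in>G i. \<forall>W\<in>G i. V \<noteq> W \<longrightarrow> (\<forall>x\<in>V. \<forall>y\<in>W. \<kappa> * \<tau> \<le> d x y)) \<and>
      boundary b \<subseteq> (\<Union>i\<le>m. \<Union>(G i))"
    by (rule ex_cover, rule that) assumption+
  have "\<exists>D. \<forall>t. \<exists>F. (\<forall>i<Suc m. coarse_family R D (F i)) \<and>
    {x. t \<le> dist x x\<^sub>0 \<and> dist x x\<^sub>0 < t + w} \<subseteq> (\<Union>i<Suc m. \<Union>(F i))" if Rw: "0 < R" "0 < w" for R w
  proof -
    \<comment> \<open>At this scale the separation \<open>\<kappa> * \<tau>\<close> exceeds the distance of the projections of any two
      points of the strip at height \<open>t\<close> that are closer than \<open>R\<close>.\<close>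
    define \<tau> where "\<tau> t = 2 * k\<^sub>2 / \<kappa> * a powr - (t - R / 2)" for t
    \<comment> \<open>The shift \<open>e\<close> rewrites \<open>\<tau> t\<close> with the factor
      \<open>k\<^sub>1\<close> that \<open>far\<close> expects.\<close>
    define e where "e = log a (2 * k\<^sub>2 / (\<kappa> * k\<^sub>1))"
    \<comment> \<open>For \<open>t \<le> T\<close> the scale reaches \<open>\<tau>\<^sub>0\<close>
      and no cover is supplied; such a strip lies in the ball of radius
      \<open>T + w\<close>.\<close>
    define T where "T = R / 2 - log a (\<tau>\<^sub>0 * \<kappa> / (2 * k\<^sub>2))"
    \<comment> \<open>The first term bounds those low strips. For the second, heights are below
      \<open>t + w\<close>, and \<open>far\<close> gives a product of at least
      \<open>t - max 0 (R / 2 + e) - C\<close>.\<close>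
    define D where "D = max (2 * (T + w)) (2 * w + 2 * C + 2 * max 0 (R / 2 + e))"
    have \<tau>_pos: "0 < \<tau> t" for t using a pos by (simp add: \<tau>_def)
    have \<tau>_eq: "\<tau> t = k\<^sub>1 * a powr - (t - R / 2 - e)" for t
    proof -
      have "a powr - (t - R / 2 - e) = a powr - (t - R / 2) * a powr e"
        by (simp add: algebra_simps flip: powr_add)
      also have "a powr e = 2 * k\<^sub>2 / (\<kappa> * k\<^sub>1)" using a pos by (simp add: e_def)
      finally show ?thesis using a by (simp add: \<tau>_def)
    qed
    have "\<exists>F. (\<forall>i<Suc m. coarse_family R D (F i)) \<and>
      {x. t \<le> dist x x\<^sub>0 \<and> dist x x\<^sub>0 < t + w} \<subseteq> (\<Union>i<Suc m. \<Union>(F i))" for t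
    proof -
      define B where "B = {x. t \<le> dist x x\<^sub>0 \<and> dist x x\<^sub>0 < t + w}"
      show ?thesis
      proof (cases "\<tau> t < \<tau>\<^sub>0")
        case True
        obtain G where G: "\<forall>i\<le>m. \<forall>V\<in>G i. \<forall>x\<in>V. \<forall>y\<in>V. d x y \<le> \<tau> t"
          "\<forall>i\<le>m. \<forall>V\<in>G i. \<forall>W\<in>G i. V \<noteq> W \<longrightarrow> (\<forall>x\<in>V. \<forall>y\<in>W. \<kappa> * \<tau> t \<le> d x y)"
          "boundary b \<subseteq> (\<Union>i\<le>m. \<Union>(G i))"
          using sep[OF \<tau>_pos True] by iprover
        define F where "F i = (\<lambda>V. \<pi> -` V \<inter> B) ` G i" for i
        have "coarse_family R D (F i)" if i: "i < Suc m" for i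
        proof (rule coarse_familyI)
          fix U x y assume "U \<in> F i" "x \<in> U" "y \<in> U"
          then obtain V where V: "V \<in> G i" "\<pi> x \<in> V" "\<pi> y \<in> V" "x \<in> B" "y \<in> B"
            by (auto simp: F_def)
          then have "d (\<pi> x) (\<pi> y) \<le> \<tau> t" using G(1) i by (simp add: less_Suc_eq_le)
          from far[OF this[unfolded \<tau>_eq]]
          show "dist x y \<le> D"
            using V(4,5) by (auto simp: B_def D_def gromov_prod_def min_def max_def split: if_splits)
        next
          fix U U' x y assume U: "U \<in> F i" "U' \<in> F i" "x \<in> U" "y \<in> U'" and xy: "dist x y < R"
          then obtain V V' where V: "V \<in> G i" "V' \<in> G i" "\<pi> x \<in> V" "\<pi> y \<in> V'" "x \<in> B" "y \<in> B"
            "U = \<pi> -` V \<inter> B" "U' = \<pi> -` V' \<inter> B"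
            by (auto simp: F_def)
          have "t - R / 2 \<le> gromov_prod x\<^sub>0 x y" using V(5,6) xy by (simp add: B_def gromov_prod_def)
          then have "a powr - gromov_prod x\<^sub>0 x y \<le> a powr - (t - R / 2)" using a(1) by simp
          then have "d (\<pi> x) (\<pi> y) \<le> k\<^sub>2 * a powr - (t - R / 2)"
            using near[of x y] a(3) by (meson mult_left_mono less_imp_le order_trans)
          also have "\<dots> < \<kappa> * \<tau> t" using a pos by (simp add: \<tau>_def)
          finally have "\<not> \<kappa> * \<tau> t \<le> d (\<pi> x) (\<pi> y)" by simp
          moreover have "i \<le> m" using i by simp
          ultimately have "V = V'" using G(2) V(1-4) by blast
          then show "U = U'" using V by simp
        qed
        moreover have "B \<subseteq> (\<Union>i<Suc m. \<Union>(F i))"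
          using \<pi> G(3) by (fastforce simp: F_def less_Suc_eq_le)
        ultimately show ?thesis unfolding B_def by blast
      next
        case False
        then have "\<tau>\<^sub>0 * \<kappa> / (2 * k\<^sub>2) \<le> a powr - (t - R / 2)"
          using a pos by (simp add: \<tau>_def field_simps)
        then have "log a (\<tau>\<^sub>0 * \<kappa> / (2 * k\<^sub>2)) \<le> - (t - R / 2)"
          using a pos by (subst log_le_iff) auto
        then have T: "t \<le> T" by (simp add: T_def)
        \<comment> \<open>The whole low strip serves as the only member of every colour.\<close>
        have "dist x y \<le> D" if "x \<in> B" "y \<in> B" for x y
          using that T dist_triangle2[of x y x\<^sub>0] by (auto simp: B_def D_def)
        then have "\<forall>i<Suc m. coarse_family R D {B}" by (simp add: coarse_family_def)
        then show ?thesis unfolding B_def[symmetric] by (intro exI[of _ "\<lambda>_. {B}"]) auto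
      qed
    qed
    then show ?thesis by blast
  qed
  then show ?thesis by blast
qed

section \<open>The inequality between the two dimensions\<close>

lemma asdim_le_if_c_cap_pos:
  fixes b :: "'a::metric_space"
  assumes "gromov_hyperbolic TYPE('a)" and "visual_space b" and "visual_metric b d"
    and "c_cap (boundary b) d m > 0"
  shows "asdim_le TYPE('a) (Suc m)"
proof -
  obtain x\<^sub>0 :: 'a where strips: "\<And>R w. 0 < R \<Longrightarrow> 0 < w \<Longrightarrow> \<exists>D. \<forall>t. \<exists>F.
      (\<forall>i<Suc m. coarse_family R D (F i)) \<and>
      {x. t \<le> dist x x\<^sub>0 \<and> dist x x\<^sub>0 < t + w} \<subseteq> (\<Union>i<Suc m. \<Union>(F i))"
    using ex_coloured_cover_of_strips[OF assms] by iprover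
  have "\<bar>dist x x\<^sub>0 - dist y x\<^sub>0\<bar> \<le> dist x y" for x y
    using dist_triangle[of x x\<^sub>0 y] dist_triangle[of y x\<^sub>0 x] by (simp add: dist_commute)
  from asdim_le_if_coloured_covers[OF ex_coloured_cover_over_line[OF this strips]] show ?thesis .
qed

theorem theorem1p1:
  fixes b :: "'a::metric_space"
    and d :: "(nat \<Rightarrow> 'a) set \<Rightarrow> (nat \<Rightarrow> 'a) set \<Rightarrow> real"
  assumes "gromov_hyperbolic TYPE('a)"
    and "visual_space b"
    and "visual_metric b d"
  shows "asdim TYPE('a) \<le> cdim (boundary b) d + 1"
proof (cases "\<exists>m. c_cap (boundary b) d m > 0")
  case True
  define m where "m = (LEAST m. c_cap (boundary b) d m > 0)"
  have "c_cap (boundary b) d m > 0" unfolding m_def using True by (rule LeastI_ex)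
  then have asdim_le: "asdim_le TYPE('a) (Suc m)" by (rule asdim_le_if_c_cap_pos[OF assms])
  then have "asdim TYPE('a) \<le> enat (Suc m)" by (auto simp: asdim_def intro: Least_le)
  also have "enat (Suc m) = cdim (boundary b) d + 1"
    using True by (simp add: cdim_def m_def one_enat_def)
  finally show ?thesis .
next
  \<comment> \<open>Here \<open>cdim\<close> is infinite, so the bound is trivial.\<close>
  case False
  then show ?thesis by (simp add: cdim_def)
qed

end
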